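(* For every integer $k\ge 1$, every deterministic online algorithm for chasing sets of cardinality at most $k$ has competitive ratio at least $D_k$, where $D_1=1$ and $D_{k+1}=2D_k+\sqrt{8+8D_k}+3$ for $k\ge 1$.
   Context: Chasing small sets: a player moves in a metric space $(M,d)$, starting at $s_0\in M$. At each time $t=1,\dots,T$ a set $S_t\subseteq M$ with $1\le|S_t|\le k$ is revealed online, and the player must move to some $s_t\in S_t$, paying $d(s_{t-1},s_t)$; $T$ and $k$ are not known to the player in advance. An online algorithm is $\rho$-competitive if on every instance its total cost is at most $\rho\cdot\min\{\sum_{t=1}^T d(x_{t-1},x_t): x_0=s_0, x_t\in S_t\}$; the competitive ratio of an algorithm is the infimum of such $\rho$. *)

theory Defs
  imports "HOL-Analysis.Analysis"
begin

text \<open>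
  A deterministic online algorithm maps a metric space \<open>(M, d)\<close>, a starting point \<open>s\<^sub>0\<close> and the
  prefix \<open>[S\<^sub>1, \<dots>, S\<^sub>t]\<close> of requests revealed so far to its position \<open>s\<^sub>t\<close>.  The space is known in
  advance; the number of requests is not.  The earlier positions of the player are not arguments,
  because they are determined by the earlier prefixes.  All points are drawn from a type \<open>'a\<close>.
\<close>

type_synonym 'a algorithm = "'a set \<Rightarrow> ('a \<Rightarrow> 'a \<Rightarrow> real) \<Rightarrow> 'a \<Rightarrow> 'a set list \<Rightarrow> 'a"

text \<open>Since infinite sets have \<^const>\<open>card\<close> zero, requests are finite.\<close>

definition set_chasing_instance ::
  "nat \<Rightarrow> 'a set \<Rightarrow> ('a \<Rightarrow> 'a \<Rightarrow> real) \<Rightarrow> 'a \<Rightarrow> 'a set list \<Rightarrow> bool" where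
  "set_chasing_instance k M d s0 Ss \<longleftrightarrow>
     Metric_space M d \<and> s0 \<in> M \<and> (\<forall>S\<in>set Ss. S \<subseteq> M \<and> 1 \<le> card S \<and> card S \<le> k)"

definition online_algorithm :: "nat \<Rightarrow> 'a algorithm \<Rightarrow> bool" where
  "online_algorithm k A \<longleftrightarrow>
     (\<forall>M d s0 Ss. set_chasing_instance k M d s0 Ss \<and> Ss \<noteq> [] \<longrightarrow> A M d s0 Ss \<in> last Ss)"

definition path_cost :: "('a \<Rightarrow> 'a \<Rightarrow> real) \<Rightarrow> 'a \<Rightarrow> 'a list \<Rightarrow> real" where
  "path_cost d s0 xs = (\<Sum>t<length xs. d ((s0 # xs) ! t) (xs ! t))"

definition alg_path ::
  "'a algorithm \<Rightarrow> 'a set \<Rightarrow> ('a \<Rightarrow> 'a \<Rightarrow> real) \<Rightarrow> 'a \<Rightarrow> 'a set list \<Rightarrow> 'a list" where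
  "alg_path A M d s0 Ss = map (\<lambda>t. A M d s0 (take t Ss)) [1..<Suc (length Ss)]"

definition alg_cost ::
  "'a algorithm \<Rightarrow> 'a set \<Rightarrow> ('a \<Rightarrow> 'a \<Rightarrow> real) \<Rightarrow> 'a \<Rightarrow> 'a set list \<Rightarrow> real" where
  "alg_cost A M d s0 Ss = path_cost d s0 (alg_path A M d s0 Ss)"

definition opt_cost :: "('a \<Rightarrow> 'a \<Rightarrow> real) \<Rightarrow> 'a \<Rightarrow> 'a set list \<Rightarrow> real" where
  "opt_cost d s0 Ss = Min {path_cost d s0 xs | xs. list_all2 (\<in>) xs Ss}"

definition competitive :: "nat \<Rightarrow> real \<Rightarrow> 'a algorithm \<Rightarrow> bool" where
  "competitive k \<rho> A \<longleftrightarrow>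
     (\<forall>M d s0 Ss. set_chasing_instance k M d s0 Ss \<longrightarrow>
        alg_cost A M d s0 Ss \<le> \<rho> * opt_cost d s0 Ss)"

text \<open>The ratio is \<open>\<infinity>\<close> if the algorithm is not \<open>\<rho>\<close>-competitive for any real \<open>\<rho>\<close>.\<close>

definition competitive_ratio :: "nat \<Rightarrow> 'a algorithm \<Rightarrow> ereal" where
  "competitive_ratio k A = Inf {ereal \<rho> | \<rho>. competitive k \<rho> A}"

text \<open>The sequence starts at index 1; the value at 0 is a dummy.\<close>

fun D_seq :: "nat \<Rightarrow> real" where
  "D_seq 0 = 0"
| "D_seq (Suc 0) = 1"
| "D_seq (Suc (Suc k)) = 2 * D_seq (Suc k) + sqrt (8 + 8 * D_seq (Suc k)) + 3"

end

theory Submission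
  imports Defs "HOL-Library.Sublist"
begin

text \<open>
  The adversary plays in a universal infinite tree, and requests always contain a chain of points
  descending to the point where it finally stops, so the optimum is at most the depth \<open>z\<close> of that
  point.  By induction, requests with \<open>k\<close> points can make the player pay \<open>\<rho>\<close> per unit of depth
  gained, for any \<open>\<rho> < D_seq k\<close>.  With one more point, the adversary plays this game in one of two
  branches, always the one where the player is, and keeps one point in the other branch.
  If the branches have depths \<open>z\<close> and \<open>y\<close>, then changing branch costs \<open>z + y\<close>, as in the cow path
  problem.  The player avoids paying \<open>\<tau>\<close> times the optimum only if the cost before the change
  satisfies \<open>c + z + y < \<tau> y\<close>; with \<open>e = c - \<rho> (z + y)\<close>, the sequence \<open>S = e + y\<close> at successive
  changes satisfies \<open>(1 + \<rho>) S'' < (\<tau> - 1) S' - (\<tau> - \<rho>) S\<close>.  An increasing sequence can do so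
  forever only if the characteristic polynomial has a real root, which fails for
  \<open>\<tau> < 2 \<rho> + 3 + \<surd>(8 + 8 \<rho>)\<close> (and \<open>\<tau>\<close> close to this bound).
\<close>

section \<open>The tree of words and its path metric\<close>

text \<open>Words are the nodes and their prefixes the ancestors, so this counts the edges of the
  path between two nodes, on either side of the meeting point.\<close>

definition tree_dist :: "nat list \<Rightarrow> nat list \<Rightarrow> real" where
  "tree_dist x y = real (card (set (prefixes x) - set (prefixes y)))
                 + real (card (set (prefixes y) - set (prefixes x)))"

lemma tree_dist_nonneg: "0 \<le> tree_dist x y"
  by (simp add: tree_dist_def)

lemma tree_dist_refl [simp]: "tree_dist x x = 0"
  by (simp add: tree_dist_def)

lemma Metric_space_tree_dist: "Metric_space UNIV tree_dist"
proof
  fix x y z :: "nat list"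
  show "0 \<le> tree_dist x y"
    by (rule tree_dist_nonneg)
  show "tree_dist x y = tree_dist y x"
    by (simp add: tree_dist_def)
  show "tree_dist x y = 0 \<longleftrightarrow> x = y"
  proof
    assume "tree_dist x y = 0"
    then have "set (prefixes x) - set (prefixes y) = {}" "set (prefixes y) - set (prefixes x) = {}"
      by (simp_all add: tree_dist_def add_nonneg_eq_0_iff)
    then have "prefix x y" "prefix y x"
      by auto
    then show "x = y"
      by (simp add: prefix_order.antisym)
  qed simp
  have *: "card (set (prefixes a) - set (prefixes c))
      \<le> card (set (prefixes a) - set (prefixes b)) + card (set (prefixes b) - set (prefixes c))"
    for a b c :: "nat list"
  proof -
    have "card (set (prefixes a) - set (prefixes c))
        \<le> card ((set (prefixes a) - set (prefixes b)) \<union> (set (prefixes b) - set (prefixes c)))"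
      by (rule card_mono) auto
    also have "\<dots> \<le> card (set (prefixes a) - set (prefixes b)) + card (set (prefixes b) - set (prefixes c))"
      by (rule card_Un_le)
    finally show ?thesis .
  qed
  show "tree_dist x z \<le> tree_dist x y + tree_dist y z"
    using *[of x z y] *[of z x y] by (simp add: tree_dist_def)
qed

lemma tree_dist_triangle: "tree_dist x z \<le> tree_dist x y + tree_dist y z"
  using Metric_space_tree_dist by (simp add: Metric_space.triangle)

lemma card_prefixes_diff:
  assumes "prefix u w"
  shows "real (card (set (prefixes w) - set (prefixes u))) = real (length w) - real (length u)"
proof -
  have "set (prefixes u) \<subseteq> set (prefixes w)"
    using assms by auto
  moreover have "card (set (prefixes x)) = Suc (length x)" for x :: "nat list"
    by (simp add: distinct_card)
  ultimately show ?thesis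
    using prefix_length_le[OF assms] by (simp add: card_Diff_subset)
qed

lemma tree_dist_prefix:
  assumes "prefix u w"
  shows "tree_dist u w = real (length w) - real (length u)"
proof -
  have "set (prefixes u) - set (prefixes w) = {}"
    using assms by auto
  then show ?thesis
    using card_prefixes_diff[OF assms] by (simp add: tree_dist_def)
qed

text \<open>A common prefix of \<open>u\<close> and \<open>v\<close> cannot go beyond
  \<open>q\<close>, where they part, so every prefix longer than \<open>q\<close> counts on its own
  side.\<close>

lemma tree_dist_branches:
  assumes "prefix (q @ [a]) u" "prefix (q @ [b]) v" "a \<noteq> b"
  shows "real (length u) - real (length q) + (real (length v) - real (length q)) \<le> tree_dist u v"
proof -
  have common: "prefix p q" if "prefix p u" "prefix p v" for p
  proof (rule ccontr)
    assume "\<not> prefix p q"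
    have "prefix p (q @ [c]) \<or> prefix (q @ [c]) p" if "prefix (q @ [c]) w" "prefix p w" for c w
      using that prefix_same_cases by blast
    then have "prefix (q @ [a]) p" "prefix (q @ [b]) p"
      using assms that \<open>\<not> prefix p q\<close> by (metis prefix_order.order_refl prefix_snoc)+
    then have "q @ [a] = q @ [b]"
      by (metis length_append_singleton prefix_length_prefix prefix_order.antisym order_refl)
    then show False
      using assms by simp
  qed
  have le: "real (length x) - real (length q) \<le> real (card (set (prefixes x) - set (prefixes y)))"
    if "prefix q x" "\<And>p. prefix p x \<Longrightarrow> prefix p y \<Longrightarrow> prefix p q" for x y
  proof -
    have "card (set (prefixes x) - set (prefixes q)) \<le> card (set (prefixes x) - set (prefixes y))"
      using that by (intro card_mono) auto
    then show ?thesis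
      using card_prefixes_diff[OF that(1)] by linarith
  qed
  have "prefix q u" "prefix q v"
    using assms by (auto simp: prefix_def)
  then show ?thesis
    using le[of u v] le[of v u] common by (simp add: tree_dist_def)
qed

section \<open>Descending chains and the offline cost\<close>

fun descends :: "nat list \<Rightarrow> nat list set list \<Rightarrow> nat list \<Rightarrow> bool" where
  "descends q [] r \<longleftrightarrow> r = q"
| "descends q (S # Ss) r \<longleftrightarrow> (\<exists>p\<in>S. prefix q p \<and> descends p Ss r)"

lemma descends_append:
  "descends q (Ss @ Ts) r \<longleftrightarrow> (\<exists>p. descends q Ss p \<and> descends p Ts r)"
  by (induction Ss arbitrary: q) auto

lemma descends_prefix: "descends q Ss r \<Longrightarrow> prefix q r"
  by (induction Ss arbitrary: q) (auto intro: prefix_order.trans)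

lemma descends_stay: "(\<And>S. S \<in> set Ss \<Longrightarrow> p \<in> S) \<Longrightarrow> descends p Ss p"
  by (induction Ss) auto

lemma path_cost_Nil [simp]: "path_cost d s [] = 0"
  by (simp add: path_cost_def)

lemma path_cost_Cons [simp]: "path_cost d s (x # xs) = d s x + path_cost d x xs"
  by (simp add: path_cost_def sum.lessThan_Suc_shift del: sum.lessThan_Suc)

text \<open>Distances along a chain of prefixes telescope. The path obtained bounds the optimum from
  above by the depth gained.\<close>

lemma descends_path:
  assumes "descends q Ss r"
  obtains xs where "list_all2 (\<in>) xs Ss" "path_cost tree_dist q xs = real (length r) - real (length q)"
proof -
  have "\<exists>xs. list_all2 (\<in>) xs Ss \<and> path_cost tree_dist q xs = real (length r) - real (length q)"
    using assms
  proof (induction Ss arbitrary: q)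
    case (Cons S Ss)
    then obtain p xs where "p \<in> S" "prefix q p" "list_all2 (\<in>) xs Ss"
      "path_cost tree_dist p xs = real (length r) - real (length p)"
      by force
    then show ?case
      by (intro exI[of _ "p # xs"]) (simp add: tree_dist_prefix)
  qed simp
  then show ?thesis
    using that by blast
qed

section \<open>Recurrences without real characteristic roots\<close>

text \<open>
  The abstract form of the search argument: \<open>S0, S1, S2\<close> are consecutive values of a sequence that
  grows by at least \<open>U\<close> per step and satisfies \<open>S2 \<le> \<alpha> S1 - \<beta> S0\<close>.  When \<open>\<alpha>\<^sup>2 < 4 \<beta>\<close> the map
  \<open>r \<mapsto> \<alpha> - \<beta> / r\<close> has no positive fixed point, so once the sequence is positive the ratio of
  consecutive values drops by at least \<open>\<eta> = 2 \<surd>\<beta> - \<alpha>\<close> per step.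
  The index \<open>m\<close> is a step from which on the sequence is nonnegative.
\<close>

definition ratio_bounded :: "real \<Rightarrow> real \<Rightarrow> real \<Rightarrow> nat \<Rightarrow> nat \<Rightarrow> real \<Rightarrow> real \<Rightarrow> bool" where
  "ratio_bounded \<alpha> \<eta> U m i S0 S1 \<longleftrightarrow>
     (real i - real m) * U \<le> S0 \<and> S0 + U \<le> S1 \<and>
     (m < i \<longrightarrow> S1 \<le> (\<alpha> - (real i - real m - 1) * \<eta>) * S0)"

lemma ratio_bounded_step:
  assumes "0 < U" "0 \<le> \<beta>" "\<eta> = 2 * sqrt \<beta> - \<alpha>"
    and inv: "ratio_bounded \<alpha> \<eta> U m i S0 S1"
    and "S1 + U \<le> S2" "S2 \<le> \<alpha> * S1 - \<beta> * S0"
  shows "ratio_bounded \<alpha> \<eta> U m (Suc i) S1 S2"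
proof -
  have grow: "(real (Suc i) - real m) * U \<le> S1"
    using inv by (simp add: ratio_bounded_def algebra_simps)
  have "S2 \<le> (\<alpha> - (real (Suc i) - real m - 1) * \<eta>) * S1" if "m < Suc i"
  proof (cases "i = m")
    \<comment> \<open>No earlier ratio is known here, but the factor of \<open>\<eta>\<close>
      vanishes, so \<open>S2 \<le> \<alpha> * S1\<close> is enough.\<close>
    case True
    then have "0 \<le> S0"
      using inv by (simp add: ratio_bounded_def)
    then have "0 \<le> \<beta> * S0"
      using assms by simp
    then show ?thesis
      using assms True by simp
  next
    case False
    with that have mi: "m < i" by simp
    define r where "r = \<alpha> - (real i - real m - 1) * \<eta>"
    have "1 \<le> real i - real m"
      using mi by linarith
    then have "1 * U \<le> (real i - real m) * U"
      using assms(1) by (intro mult_right_mono) auto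
    moreover have "(real i - real m) * U \<le> S0"
      using inv by (simp add: ratio_bounded_def)
    ultimately have "0 < S0"
      using assms(1) by linarith
    have S1: "S1 \<le> r * S0" "S0 < S1"
      using inv mi assms(1) by (auto simp: ratio_bounded_def r_def)
    then have "0 < r"
      using \<open>0 < S0\<close> by (smt (verit) mult_nonpos_nonneg)
    \<comment> \<open>This yields \<open>2 * sqrt \<beta> - r \<le> \<beta> / r\<close>, hence
      \<open>\<alpha> - \<beta> / r \<le> r - \<eta>\<close>.\<close>
    have "0 \<le> (r - sqrt \<beta>)\<^sup>2"
      by simp
    then have le: "2 * sqrt \<beta> * r - r * r \<le> \<beta>"
      using \<open>0 \<le> \<beta>\<close> by (simp add: power2_eq_square algebra_simps)
    have "S1 / r \<le> S0"
      using S1 \<open>0 < r\<close> by (simp add: field_simps)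
    then have "\<beta> * (S1 / r) \<le> \<beta> * S0"
      using \<open>0 \<le> \<beta>\<close> by (rule mult_left_mono)
    moreover have "(2 * sqrt \<beta> - r) * S1 \<le> \<beta> * (S1 / r)"
    proof -
      have "(2 * sqrt \<beta> - r) \<le> \<beta> / r"
        using le \<open>0 < r\<close> by (simp add: field_simps)
      then show ?thesis
        using \<open>0 < S0\<close> S1 mult_right_mono[of "2 * sqrt \<beta> - r" "\<beta> / r" S1] by simp
    qed
    ultimately have "S2 \<le> \<alpha> * S1 - (2 * sqrt \<beta> - r) * S1"
      using assms by linarith
    also have "\<dots> = (\<alpha> + r - 2 * sqrt \<beta>) * S1"
      by (simp add: algebra_simps)
    also have "\<alpha> + r - 2 * sqrt \<beta> = \<alpha> - (real (Suc i) - real m - 1) * \<eta>"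
      unfolding r_def assms(3) by (simp add: algebra_simps)
    finally show ?thesis .
  qed
  then show ?thesis
    using grow assms by (simp add: ratio_bounded_def)
qed

text \<open>Past index \<open>m\<close> the values are positive and increasing, so the falling bound
  on their ratio cannot reach zero. This limits the number of changes of branch.\<close>

lemma ratio_bounded_less:
  assumes "ratio_bounded \<alpha> \<eta> U m i S0 S1" "0 < U" "m < i"
  shows "(real i - real m - 1) * \<eta> < \<alpha>"
proof (rule ccontr)
  assume "\<not> (real i - real m - 1) * \<eta> < \<alpha>"
  have "0 < (real i - real m) * U"
    using assms by simp
  moreover have "(real i - real m) * U \<le> S0" "S0 + U \<le> S1"
    "S1 \<le> (\<alpha> - (real i - real m - 1) * \<eta>) * S0"
    using assms by (auto simp: ratio_bounded_def)
  ultimately have "0 < S0" "S0 < S1" "S1 \<le> (\<alpha> - (real i - real m - 1) * \<eta>) * S0"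
    using assms(2) by linarith+
  moreover have "(\<alpha> - (real i - real m - 1) * \<eta>) * S0 \<le> 0"
    using \<open>\<not> (real i - real m - 1) * \<eta> < \<alpha>\<close> \<open>0 < S0\<close> by (intro mult_nonpos_nonneg) auto
  ultimately show False
    by linarith
qed

section \<open>The game against a fixed player\<close>

definition valid_requests :: "nat \<Rightarrow> 'b set list \<Rightarrow> bool" where
  "valid_requests K H \<longleftrightarrow> (\<forall>S\<in>set H. finite S \<and> S \<noteq> {} \<and> card S \<le> K)"

lemma valid_requests_append [simp]:
  "valid_requests K (H @ Ss) \<longleftrightarrow> valid_requests K H \<and> valid_requests K Ss"
  by (auto simp: valid_requests_def)

lemma D_seq_ge_one: "1 \<le> k \<Longrightarrow> 1 \<le> D_seq k"
proof (induction k rule: nat_induct_at_least)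
  case (Suc k)
  then show ?case
    by (cases k) auto
qed simp

locale tree_player =
  fixes K :: nat and pos :: "nat list set list \<Rightarrow> nat list"
  assumes pos_in: "valid_requests K H \<Longrightarrow> H \<noteq> [] \<Longrightarrow> pos H \<in> last H"
begin

definition cost :: "nat list set list \<Rightarrow> real" where
  "cost H = (\<Sum>t<length H. tree_dist (pos (take t H)) (pos (take (Suc t) H)))"

lemma cost_snoc: "cost (H @ [S]) = cost H + tree_dist (pos H) (pos (H @ [S]))"
proof -
  have "cost (H @ [S]) = (\<Sum>t<length H. tree_dist (pos (take t (H @ [S]))) (pos (take (Suc t) (H @ [S]))))
      + tree_dist (pos H) (pos (H @ [S]))"
    by (simp add: cost_def)
  also have "(\<Sum>t<length H. tree_dist (pos (take t (H @ [S]))) (pos (take (Suc t) (H @ [S])))) = cost H"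
    unfolding cost_def by (intro sum.cong) auto
  finally show ?thesis .
qed

lemma cost_append_ge: "cost H + tree_dist (pos H) (pos (H @ Ss)) \<le> cost (H @ Ss)"
proof (induction Ss rule: rev_induct)
  case (snoc S Ss)
  then show ?case
    using cost_snoc[of "H @ Ss" S] tree_dist_triangle[of "pos H" "pos (H @ Ss @ [S])" "pos (H @ Ss)"]
    by simp
qed simp

text \<open>
  \<open>F\<close> is a set of points kept available in every request; the adversary gives up the subgame as soon
  as the player moves there, and then retains only the point \<open>r\<close> of the subgame.
\<close>

definition outcome ::
  "nat \<Rightarrow> real \<Rightarrow> nat list set list \<Rightarrow> nat list set \<Rightarrow> nat list \<Rightarrow> nat list set list \<Rightarrow> nat list \<Rightarrow> bool" where
  "outcome C \<rho> H F q Ss r \<longleftrightarrow>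
     valid_requests K Ss \<and> (\<forall>S\<in>set Ss. F \<subseteq> S) \<and> descends q Ss r \<and> length r \<le> length q + C \<and>
     (pos (H @ Ss) \<in> F \<or>
      pos (H @ Ss) = r \<and> length q < length r \<and>
      cost H + \<rho> * (real (length r) - real (length q)) \<le> cost (H @ Ss))"

text \<open>\<open>C\<close> is uniform in \<open>H\<close> and \<open>F\<close> because the
  induction step fixes its starting depth from \<open>C\<close> before the subgames arise, each with
  its own history and waiting point.\<close>

definition forces :: "nat \<Rightarrow> real \<Rightarrow> bool" where
  "forces k \<rho> \<longleftrightarrow> (\<exists>C. \<forall>H F. valid_requests K H \<and> finite F \<and> card F + k \<le> K \<longrightarrow>
     (\<exists>Ss r. outcome C \<rho> H F (pos H) Ss r))"

lemma forces_mono: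
  assumes "forces k \<rho>" "\<rho>' \<le> \<rho>"
  shows "forces k \<rho>'"
proof -
  have "outcome C \<rho>' H F q Ss r" if "outcome C \<rho> H F q Ss r" for C H F q Ss r
  proof -
    have "\<rho>' * (real (length r) - real (length q)) \<le> \<rho> * (real (length r) - real (length q))"
      if "length q < length r"
      using that assms(2) by (intro mult_right_mono) auto
    with that show ?thesis
      unfolding outcome_def by linarith
  qed
  then show ?thesis
    using assms(1) unfolding forces_def by meson
qed

lemma pos_snoc:
  assumes "valid_requests K H" "finite T" "T \<union> F \<noteq> {}" "finite F" "card T + card F \<le> K"
  shows "valid_requests K [T \<union> F] \<and> pos (H @ [T \<union> F]) \<in> T \<union> F"
proof -
  have "card (T \<union> F) \<le> K"
    using card_Un_le[of T F] assms by linarith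
  then have "valid_requests K [T \<union> F]"
    using assms by (simp add: valid_requests_def)
  then show ?thesis
    using pos_in[of "H @ [T \<union> F]"] assms by simp
qed

lemma forces_one: "forces 1 1"
  unfolding forces_def
proof (rule exI[of _ 1], intro allI impI)
  fix H :: "nat list set list" and F :: "nat list set"
  assume A: "valid_requests K H \<and> finite F \<and> card F + 1 \<le> K"
  define r where "r = pos H @ [0]"
  have v: "valid_requests K [{r} \<union> F]" "pos (H @ [{r} \<union> F]) \<in> {r} \<union> F"
    using pos_snoc[of H "{r}" F] A by auto
  have "tree_dist (pos H) r = 1"
    by (simp add: r_def tree_dist_prefix)
  then have "outcome 1 1 H F (pos H) [{r} \<union> F] r"
    using v cost_snoc[of H "{r} \<union> F"] by (auto simp: outcome_def r_def)
  then show "\<exists>Ss r. outcome 1 1 H F (pos H) Ss r"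
    by blast
qed

section \<open>One more point: search in two branches\<close>

text \<open>
  Abandoning a subgame may leave the branch up to \<open>C\<close> deeper without the player having paid for it.
  Starting both branches at a depth \<open>N\<close> much larger than \<open>C\<close> and charging only \<open>lam\<close> times the cost of
  a change of branch absorbs this loss; scaling \<open>\<rho>\<close> and \<open>\<tau>\<close> by \<open>lam\<close> too keeps the recurrence intact.
\<close>

lemma forces_Suc:
  assumes forces: "forces k (lam * D)"
    and "1 \<le> k" "0 \<le> D" "0 < lam" "lam < 1" "1 < t"
    and disc: "(t - 1)\<^sup>2 < 4 * (1 + D) * (t - D)"
  shows "forces (Suc k) (lam * t)"
proof -
  define \<rho> \<tau> where "\<rho> = lam * D" and "\<tau> = lam * t"
  \<comment> \<open>Coefficients of \<open>(1 + D) * S2 \<le> (t - 1) * S1 - (t - D) * S0\<close>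
    after division by \<open>1 + D\<close>; \<open>disc\<close> becomes a negative
    discriminant.\<close>
  define \<alpha> \<beta> where "\<alpha> = (t - 1) / (1 + D)" and "\<beta> = (t - D) / (1 + D)"
  define \<eta> where "\<eta> = 2 * sqrt \<beta> - \<alpha>"
  have "0 \<le> \<rho>" "0 < \<tau>"
    using assms by (auto simp: \<rho>_def \<tau>_def)
  have "0 < 4 * (1 + D) * (t - D)"
    using disc zero_le_power2[of "t - 1"] by linarith
  then have "D < t"
    using \<open>0 \<le> D\<close> by (simp add: zero_less_mult_iff)
  then have "0 \<le> \<beta>"
    using \<open>0 \<le> D\<close> by (simp add: \<beta>_def)
  have "\<alpha>\<^sup>2 < 4 * \<beta>"
  proof -
    have "\<alpha>\<^sup>2 = (t - 1)\<^sup>2 / (1 + D)\<^sup>2"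
      by (simp add: \<alpha>_def power_divide)
    also have "\<dots> < 4 * (1 + D) * (t - D) / (1 + D)\<^sup>2"
      using disc \<open>0 \<le> D\<close> by (intro divide_strict_right_mono) auto
    also have "\<dots> = 4 * \<beta>"
      using \<open>0 \<le> D\<close> unfolding \<beta>_def power2_eq_square mult.assoc by simp
    finally show ?thesis .
  qed
  then have "\<alpha> < sqrt (4 * \<beta>)"
    by (rule real_less_rsqrt)
  then have "0 < \<eta>"
    by (simp add: \<eta>_def real_sqrt_mult)
  obtain C where C: "\<And>H F. valid_requests K H \<Longrightarrow> finite F \<Longrightarrow> card F + k \<le> K \<Longrightarrow>
      \<exists>Ss r. outcome C \<rho> H F (pos H) Ss r"
    using forces unfolding forces_def \<rho>_def by blast
  obtain N0 :: nat where N0: "(1 + \<rho>) * real C / (2 * (1 - lam)) \<le> real N0"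
    using real_arch_simple by blast
  define N where "N = Suc N0"
  have N: "(1 + \<rho>) * real C \<le> 2 * (1 - lam) * real N" "1 \<le> real N"
  proof -
    have "(1 + \<rho>) * real C / (2 * (1 - lam)) \<le> real N"
      using N0 by (simp add: N_def)
    then show "(1 + \<rho>) * real C \<le> 2 * (1 - lam) * real N"
      using \<open>lam < 1\<close> by (simp add: field_simps)
  qed (simp add: N_def)
  \<comment> \<open>The sequence starts at \<open>N * (1 - 2 * \<rho> - lam)\<close>, possibly
    negative, and gains at least \<open>2 * lam * N\<close> per change, so \<open>m\<close> changes
    make it nonnegative.\<close>
  obtain m :: nat where m: "2 * \<rho> + lam - 1 \<le> 2 * lam * real m"
  proof -
    obtain m :: nat where "(2 * \<rho> + lam - 1) / (2 * lam) \<le> real m"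
      using real_arch_simple by blast
    then show ?thesis
      using that \<open>0 < lam\<close> by (simp add: field_simps)
  qed
  \<comment> \<open>By index \<open>n0\<close> the bound on the ratio would no longer be
    positive.\<close>
  obtain n0 :: nat where n0: "m < n0" "\<alpha> \<le> (real n0 - real m - 1) * \<eta>"
  proof -
    obtain j :: nat where "\<alpha> / \<eta> \<le> real j"
      using real_arch_simple by blast
    then show ?thesis
      using that[of "m + 1 + j"] \<open>0 < \<eta>\<close> by (simp add: field_simps)
  qed
  \<comment> \<open>While play goes on, \<open>dep u < \<tau> * dep v\<close>, a subgame adds at
    most \<open>C\<close>, and \<open>dep v\<close> is at least 1. So \<open>R\<close> bounds the
    growth of depth per change, and \<open>C'\<close> bounds all depths that occur.\<close>
  define R where "R = \<tau> + real C + 1"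
  define U where "U = 2 * lam * real N"
  define C' where "C' = nat \<lceil>real N * R ^ Suc n0\<rceil>"
  have "1 \<le> R"
    using \<open>0 < \<tau>\<close> by (simp add: R_def)
  have "0 < U"
    using \<open>0 < lam\<close> by (simp add: U_def N_def)
  show ?thesis
    unfolding forces_def \<tau>_def[symmetric]
  proof (rule exI[of _ C'], intro allI impI)
    fix H :: "nat list set list" and F :: "nat list set"
    assume "valid_requests K H \<and> finite F \<and> card F + Suc k \<le> K"
    then have H: "valid_requests K H" and F: "finite F" "card F + Suc k \<le> K"
      by auto
    define q where "q = pos H"
    define dep where "dep = (\<lambda>u::nat list. real (length u) - real (length q))"
    \<comment> \<open>The invariant after \<open>i\<close> changes: the player is at
      \<open>u\<close>, and \<open>v\<close> waits in the other branch. The surplus \<open>e\<close>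
      is updated only at a change; \<open>e - lam * dep v\<close> and \<open>e + lam * dep v\<close>
      are the consecutive values of the sequence.\<close>
    define st where "st = (\<lambda>i e Ss u v.
      valid_requests K Ss \<and> (\<forall>S\<in>set Ss. F \<subseteq> S) \<and> descends q Ss u \<and> descends q Ss v \<and>
      pos (H @ Ss) = u \<and> (\<exists>a b. a \<noteq> b \<and> prefix (q @ [a]) u \<and> prefix (q @ [b]) v) \<and>
      N \<le> dep u \<and> N \<le> dep v \<and> dep u \<le> N * R ^ Suc i \<and> dep v \<le> N * R ^ i \<and>
      cost H + e + \<rho> * (dep u + dep v) \<le> cost (H @ Ss) \<and>
      ratio_bounded \<alpha> \<eta> U m i (e - lam * dep v) (e + lam * dep v))"
    have len: "length u \<le> length q + C'" if "dep u \<le> N * R ^ j" "j \<le> Suc n0" for u j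
    proof -
      have "R ^ j \<le> R ^ Suc n0"
        using \<open>1 \<le> R\<close> that by (intro power_increasing)
      then have "N * R ^ j \<le> N * R ^ Suc n0"
        by (intro mult_left_mono) auto
      then have "dep u \<le> real C'"
        using that(1) unfolding C'_def by linarith
      then show ?thesis
        by (simp add: dep_def)
    qed
    \<comment> \<open>Lexicographic descent: a change of branch raises \<open>i\<close>; otherwise
      \<open>u\<close> gets deeper, within the limit \<open>C'\<close>.\<close>
    have main: "st i e Ss u v \<longrightarrow> p = (n0 - i, length q + C' - length u) \<longrightarrow>
        (\<exists>Ts r. outcome C' \<tau> H F q Ts r)" for p i e Ss u v
    proof (induction p arbitrary: i e Ss u v rule: wf_induct_rule[OF wf_lex_prod[OF wf_less_than wf_less_than]])
      case (1 p)
      show ?case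
      proof (intro impI)
        assume "st i e Ss u v" and p: "p = (n0 - i, length q + C' - length u)"
        then have Ss: "valid_requests K Ss" "\<forall>S\<in>set Ss. F \<subseteq> S" "descends q Ss u" "descends q Ss v"
          and posu: "pos (H @ Ss) = u"
          and br: "\<exists>a b. a \<noteq> b \<and> prefix (q @ [a]) u \<and> prefix (q @ [b]) v"
          and dge: "N \<le> dep u" "N \<le> dep v" and dle: "dep u \<le> N * R ^ Suc i" "dep v \<le> N * R ^ i"
          and co: "cost H + e + \<rho> * (dep u + dep v) \<le> cost (H @ Ss)"
          and rb: "ratio_bounded \<alpha> \<eta> U m i (e - lam * dep v) (e + lam * dep v)"
          unfolding st_def by auto
        have "i < n0"
        proof (rule ccontr)
          assume "\<not> i < n0"
          then have "m < i" "(real n0 - real m - 1) * \<eta> \<le> (real i - real m - 1) * \<eta>"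
            using n0 \<open>0 < \<eta>\<close> by (auto intro!: mult_right_mono)
          then show False
            using ratio_bounded_less[OF rb \<open>0 < U\<close>] n0 by linarith
        qed
        have lenu: "length u \<le> length q + C'" and lenv: "length v \<le> length q + C'"
          using len[OF dle(1)] len[OF dle(2)] \<open>i < n0\<close> by linarith+
        have dpos: "0 < dep u" "0 < dep v"
          using dge N by linarith+
        then have ltu: "length q < length u" and ltv: "length q < length v"
          by (auto simp: dep_def)
        have duv: "dep u + dep v \<le> tree_dist u v"
          using br tree_dist_branches unfolding dep_def by blast
        \<comment> \<open>Either the price for \<open>u\<close> is already paid, or offering only
          \<open>v\<close> besides \<open>F\<close> makes the move to \<open>v\<close> pay its
          price, or the subgame continues below \<open>u\<close>.\<close>
        consider
            (stop) "cost H + \<tau> * dep u \<le> cost (H @ Ss)"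
          | (force) "cost H + \<tau> * dep v \<le> cost (H @ Ss) + dep u + dep v"
          | (play) "cost (H @ Ss) + dep u + dep v < cost H + \<tau> * dep v"
          by linarith
        then show "\<exists>Ts r. outcome C' \<tau> H F q Ts r"
        proof cases
          case stop
          then have "outcome C' \<tau> H F q Ss u"
            using Ss posu lenu ltu by (simp add: outcome_def dep_def)
          then show ?thesis
            by blast
        next
          case force
          have v: "valid_requests K [{v} \<union> F]" "pos (H @ Ss @ [{v} \<union> F]) \<in> {v} \<union> F"
            using pos_snoc[of "H @ Ss" "{v}" F] H Ss F by auto
          have "cost H + \<tau> * dep v \<le> cost (H @ Ss @ [{v} \<union> F])" if "pos (H @ Ss @ [{v} \<union> F]) = v"
            using cost_snoc[of "H @ Ss" "{v} \<union> F"] that force duv posu by simp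
          then have "outcome C' \<tau> H F q (Ss @ [{v} \<union> F]) v"
            using v Ss lenv ltv by (auto simp: outcome_def dep_def descends_append)
          then show ?thesis
            by blast
        next
          case play
          \<comment> \<open>One point is reserved for \<open>v\<close>, which joins the kept set: a
            change of branch thus ends the subgame on \<open>k\<close> points.\<close>
          have "card (insert v F) + k \<le> K"
            using F card_insert_le_m1[of "Suc (card F)" F v] by (simp add: card_insert_if)
          then obtain Ts r where "outcome C \<rho> (H @ Ss) (insert v F) u Ts r"
            using C[of "H @ Ss" "insert v F"] H Ss F posu by auto
          then have Ts: "valid_requests K Ts" "\<forall>S\<in>set Ts. insert v F \<subseteq> S" "descends u Ts r"
            and lenr: "length r \<le> length u + C"
            and out: "pos (H @ Ss @ Ts) \<in> insert v F \<or> pos (H @ Ss @ Ts) = r \<and> length u < length r \<and>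
               cost (H @ Ss) + \<rho> * (real (length r) - real (length u)) \<le> cost (H @ Ss @ Ts)"
            by (auto simp: outcome_def)
          have ext: "valid_requests K (Ss @ Ts)" "\<forall>S\<in>set (Ss @ Ts). F \<subseteq> S"
            "descends q (Ss @ Ts) r" "descends q (Ss @ Ts) v"
            using Ss Ts descends_stay[of Ts v] by (auto simp: descends_append)
          have pr: "prefix u r"
            using Ts descends_prefix by blast
          then have dr: "dep u \<le> dep r" "dep r \<le> dep u + C"
            using lenr prefix_length_le[OF pr] by (auto simp: dep_def)
          have "cost H \<le> cost (H @ Ss)"
            using cost_append_ge[of H Ss] tree_dist_nonneg[of "pos H" "pos (H @ Ss)"] by linarith
          then have "dep u < \<tau> * dep v"
            using play dpos by linarith
          moreover have "real C * 1 \<le> real C * dep v"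
            using dge N by (intro mult_left_mono) auto
          ultimately have "dep r \<le> R * dep v"
            using dr dpos by (simp add: R_def algebra_simps)
          also have "\<dots> \<le> R * (N * R ^ i)"
            using dle \<open>1 \<le> R\<close> by (intro mult_left_mono) auto
          finally have drR: "dep r \<le> N * R ^ Suc i"
            by (simp add: mult_ac)
          have lenr': "length r \<le> length q + C'"
            using len[OF drR] \<open>i < n0\<close> by linarith
          consider (exit) "pos (H @ Ss @ Ts) \<in> F" | (switch) "pos (H @ Ss @ Ts) = v"
            | (advance) "pos (H @ Ss @ Ts) = r" "length u < length r"
               "cost (H @ Ss) + \<rho> * (real (length r) - real (length u)) \<le> cost (H @ Ss @ Ts)"
            using out by auto
          then show ?thesis
          proof cases
            case exit
            then have "outcome C' \<tau> H F q (Ss @ Ts) r"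
              using ext lenr' unfolding outcome_def by blast
            then show ?thesis
              by blast
          next
            case advance
            have "cost H + e + \<rho> * (dep r + dep v) \<le> cost (H @ Ss @ Ts)"
              using co advance by (simp add: dep_def algebra_simps)
            moreover have "\<exists>a b. a \<noteq> b \<and> prefix (q @ [a]) r \<and> prefix (q @ [b]) v"
              using br pr prefix_order.trans by blast
            ultimately have "st i e (Ss @ Ts) r v"
              unfolding st_def using ext advance dge dr drR dle rb by auto
            moreover have "((n0 - i, length q + C' - length r), p) \<in> less_than <*lex*> less_than"
              using p advance lenr' by auto
            ultimately show ?thesis
              using "1.IH" by blast
          next
            case switch
            have cs: "cost (H @ Ss) + dep u + dep v \<le> cost (H @ Ss @ Ts)"
              using cost_append_ge[of "H @ Ss" Ts] duv posu switch by simp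
            show ?thesis
            proof (cases "cost H + \<tau> * dep v \<le> cost (H @ Ss @ Ts)")
              case True
              then have "outcome C' \<tau> H F q (Ss @ Ts) v"
                using ext switch lenv ltv by (simp add: outcome_def dep_def)
              then show ?thesis
                by blast
            next
              case False
              define e' where "e' = e + lam * (dep r + dep v)"
              \<comment> \<open>The unpaid descent from \<open>u\<close> to \<open>r\<close> costs
                at most the share \<open>1 - lam\<close> withheld from the price of the
                change.\<close>
              have "(1 + \<rho>) * (dep r - dep u) \<le> (1 + \<rho>) * C"
                using dr \<open>0 \<le> \<rho>\<close> by (intro mult_left_mono) auto
              also have "\<dots> \<le> (1 - lam) * (2 * N)"
                using N by (simp add: algebra_simps)
              also have "\<dots> \<le> (1 - lam) * (dep r + dep v)"
                using dge dr \<open>lam < 1\<close> by (intro mult_left_mono) auto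
              finally have co': "cost H + e' + \<rho> * (dep v + dep r) \<le> cost (H @ Ss @ Ts)"
                using co cs by (simp add: e'_def algebra_simps)
              have "e' + \<rho> * (dep v + dep r) \<le> \<tau> * dep v"
                using co' False by linarith
              \<comment> \<open>With \<open>S0 = e - lam * dep v\<close>,
                \<open>S1 = e + lam * dep v\<close> and \<open>S2 = e' + lam * dep r\<close>, one
                has \<open>e' = (S1 + S2) / 2\<close>, \<open>dep v = (S1 - S0) / (2 * lam)\<close>
                and \<open>dep r = (S2 - S1) / (2 * lam)\<close>; substitution gives the
                recurrence.\<close>
              moreover have "(t - 1) * (e + lam * dep v) - (t - D) * (e - lam * dep v)
                  - (1 + D) * (e' + lam * dep r) = 2 * (\<tau> * dep v - (e' + \<rho> * (dep v + dep r)))"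
                by (simp add: e'_def \<rho>_def \<tau>_def algebra_simps)
              moreover have "0 \<le> 2 * (\<tau> * dep v - (e' + \<rho> * (dep v + dep r)))"
                using calculation(1) by simp
              ultimately have "(1 + D) * (e' + lam * dep r)
                  \<le> (t - 1) * (e + lam * dep v) - (t - D) * (e - lam * dep v)"
                by (metis diff_ge_0_iff_ge)
              then have "e' + lam * dep r
                  \<le> ((t - 1) * (e + lam * dep v) - (t - D) * (e - lam * dep v)) / (1 + D)"
                using \<open>0 \<le> D\<close> by (simp add: field_simps)
              then have rec: "e' + lam * dep r \<le> \<alpha> * (e + lam * dep v) - \<beta> * (e - lam * dep v)"
                unfolding \<alpha>_def \<beta>_def by (simp only: diff_divide_distrib[of "_ * _"] times_divide_eq_left)
              have "lam * N \<le> lam * dep r"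
                using dge dr \<open>0 < lam\<close> by (intro mult_left_mono) auto
              then have "e + lam * dep v + U \<le> e' + lam * dep r"
                by (simp add: e'_def U_def algebra_simps)
              then have "ratio_bounded \<alpha> \<eta> U m (Suc i) (e + lam * dep v) (e' + lam * dep r)"
                using ratio_bounded_step[OF \<open>0 < U\<close> \<open>0 \<le> \<beta>\<close> \<eta>_def rb] rec by blast
              moreover have "e + lam * dep v = e' - lam * dep r"
                by (simp add: e'_def algebra_simps)
              moreover have "R ^ i \<le> R ^ Suc (Suc i)"
                using \<open>1 \<le> R\<close> by (intro power_increasing) auto
              then have "N * R ^ i \<le> N * R ^ Suc (Suc i)"
                by (intro mult_left_mono) auto
              then have "dep v \<le> N * R ^ Suc (Suc i)"
                using dle by linarith
              moreover have "\<exists>a b. a \<noteq> b \<and> prefix (q @ [a]) v \<and> prefix (q @ [b]) r"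
                using br pr prefix_order.trans by metis
              ultimately have "st (Suc i) e' (Ss @ Ts) v r"
                unfolding st_def using ext switch dge dr drR co' by auto
              moreover have "((n0 - Suc i, length q + C' - length v), p) \<in> less_than <*lex*> less_than"
                using p \<open>i < n0\<close> by auto
              ultimately show ?thesis
                using "1.IH" by blast
            qed
          qed
        qed
      qed
    qed
    \<comment> \<open>The branches part at \<open>q\<close> itself; \<open>N\<close> is positive, so
      their first letters differ.\<close>
    define w where "w = (\<lambda>a. q @ replicate N a)"
    define S where "S = {w 0, w 1} \<union> F"
    have "card {w 0, w 1} + card F \<le> K"
      using F \<open>1 \<le> k\<close> card_insert_le_m1[of 2 "{w 1}" "w 0"] by simp
    then have vS: "valid_requests K [S]" and "pos (H @ [S]) \<in> S"
      using pos_snoc[of H "{w 0, w 1}" F] H F by (auto simp: S_def)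
    have depw: "dep (w a) = N" and pw: "prefix q (w a)" "prefix (q @ [a]) (w a)" for a
      by (auto simp: dep_def w_def N_def)
    have NR: "real N * 1 \<le> N * R ^ j" for j
      using \<open>1 \<le> R\<close> by (intro mult_left_mono) auto
    have start: "\<exists>Ts r. outcome C' \<tau> H F q Ts r" if "pos (H @ [S]) = w a" "a \<noteq> b" "{a, b} = {0, 1}" for a b
    proof -
      \<comment> \<open>The first move costs \<open>N\<close> and both depths are \<open>N\<close>,
        so the cost bound of \<open>st\<close> starts as an equality.\<close>
      define e where "e = real N * (1 - 2 * \<rho>)"
      have "w a \<in> S" "w b \<in> S"
        using that by (auto simp: S_def doubleton_eq_iff)
      moreover have "tree_dist q (w a) = N"
        using tree_dist_prefix[OF pw(1)] depw[of a] by (simp add: dep_def)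
      then have "cost (H @ [S]) = cost H + N"
        using cost_snoc[of H S] that by (simp add: q_def)
      moreover have "ratio_bounded \<alpha> \<eta> U m 0 (e - lam * N) (e + lam * N)"
      proof -
        have "(2 * \<rho> + lam - 1) * N \<le> 2 * lam * m * N"
          using m by (intro mult_right_mono) auto
        then show ?thesis
          by (simp add: ratio_bounded_def e_def U_def algebra_simps)
      qed
      moreover have "\<exists>a' b'. a' \<noteq> b' \<and> prefix (q @ [a']) (w a) \<and> prefix (q @ [b']) (w b)"
        using pw that by blast
      ultimately have "st 0 e [S] (w a) (w b)"
        unfolding st_def using vS pw that depw NR[of 0] NR[of 1]
        by (auto simp: S_def e_def algebra_simps)
      then show ?thesis
        using main by blast
    qed
    show "\<exists>Ss r. outcome C' \<tau> H F (pos H) Ss r"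
      unfolding q_def[symmetric]
    proof (cases "pos (H @ [S]) \<in> F")
      case True
      have "length (w 0) \<le> length q + C'"
        using len[of "w 0" 0] depw NR[of 0] by simp
      then have "outcome C' \<tau> H F q [S] (w 0)"
        using True vS pw by (auto simp: outcome_def S_def)
      then show "\<exists>Ss r. outcome C' \<tau> H F q Ss r"
        by blast
    next
      case False
      then have "pos (H @ [S]) = w 0 \<or> pos (H @ [S]) = w 1"
        using \<open>pos (H @ [S]) \<in> S\<close> by (auto simp: S_def)
      then show "\<exists>Ss r. outcome C' \<tau> H F q Ss r"
        using start[of 0 1] start[of 1 0] by auto
    qed
  qed
qed

section \<open>Induction on the size of the requests\<close>

lemma forces_D_seq:
  assumes "1 \<le> k" "\<rho> < D_seq k"
  shows "forces k \<rho>"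
  using assms
proof (induction k arbitrary: \<rho> rule: nat_induct_at_least)
  case base
  then show ?case
    using forces_mono[OF forces_one] by simp
next
  case (Suc k)
  define D s where "D = D_seq k" and "s = sqrt (8 + 8 * D)"
  have "1 \<le> D"
    using D_seq_ge_one Suc by (simp add: D_def)
  then have s: "s\<^sup>2 = 8 + 8 * D" "0 < s"
    by (auto simp: s_def)
  have DS: "D_seq (Suc k) = 2 * D + s + 3"
    using Suc.hyps by (cases k) (auto simp: D_def s_def)
  \<comment> \<open>Raising \<open>\<rho>\<close> to \<open>2 * D + 3\<close> makes the base of the
    square below nonnegative. With \<open>lam = \<rho>' / t < 1\<close>, the target
    \<open>lam * t\<close> is \<open>\<rho>'\<close>, and \<open>lam * D < D\<close> admits the
    induction hypothesis.\<close>
  define \<rho>' where "\<rho>' = max \<rho> (2 * D + 3)"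
  define t where "t = (\<rho>' + (2 * D + s + 3)) / 2"
  have \<rho>': "\<rho> \<le> \<rho>'" "2 * D + 3 \<le> \<rho>'" "\<rho>' < 2 * D + s + 3"
    using Suc.prems DS s by (auto simp: \<rho>'_def)
  then have t: "\<rho>' < t" "t < 2 * D + s + 3"
    by (auto simp: t_def)
  \<comment> \<open>Completing the square turns the discriminant condition into this; its roots are
    \<open>2 * D + 3 - s\<close> and \<open>2 * D + 3 + s\<close>.\<close>
  have "(t - 2 * D - 3)\<^sup>2 < s\<^sup>2"
    using t \<rho>' by (intro power_strict_mono) auto
  then have "(t - 1)\<^sup>2 < 4 * (1 + D) * (t - D)"
    using s by (simp add: power2_eq_square algebra_simps)
  moreover have "\<rho>' / t * D < D"
    using t \<rho>' \<open>1 \<le> D\<close> by (simp add: field_simps)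
  then have "forces k (\<rho>' / t * D)"
    using Suc.IH by (simp add: D_def)
  ultimately have "forces (Suc k) (\<rho>' / t * t)"
    using t \<rho>' \<open>1 \<le> D\<close> Suc.hyps by (intro forces_Suc[of k _ D]) auto
  then show ?case
    using t \<rho>' \<open>1 \<le> D\<close> forces_mono by simp
qed

end

section \<open>From the tree to the competitive ratio\<close>

theorem theorem3:
  fixes k :: nat and A :: "'a algorithm"
  assumes "infinite (UNIV :: 'a set)"
    and "k \<ge> 1"
    and "online_algorithm k A"
  shows "ereal (D_seq k) \<le> competitive_ratio k A"
proof -
  obtain h :: "nat \<Rightarrow> 'a" where "inj h"
    using assms(1) infinite_countable_subset by blast
  define f where "f = (\<lambda>x::nat list. h (to_nat x))"
  have "inj f"
    unfolding f_def by (intro injI) (metis \<open>inj h\<close> injD from_nat_to_nat)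
  define g where "g = inv f"
  have gf [simp]: "g (f x) = x" for x
    using \<open>inj f\<close> by (simp add: g_def)
  define M where "M = range f"
  define d where "d = (\<lambda>x y. tree_dist (g x) (g y))"
  \<comment> \<open>The value of \<open>A\<close> on the empty list is unconstrained, so the start
    is set to the root.\<close>
  define pos where "pos = (\<lambda>H. if H = [] then [] else g (A M d (f []) (map ((`) f) H)))"
  interpret T: Metric_space UNIV tree_dist
    by (rule Metric_space_tree_dist)
  have "Metric_space M d"
    by unfold_locales (auto simp: d_def M_def T.commute T.triangle)
  then have inst: "set_chasing_instance k M d (f []) (map ((`) f) H)" if "valid_requests k H" for H
    using that \<open>inj f\<close>
    by (fastforce simp: set_chasing_instance_def M_def valid_requests_def card_image inj_on_subset
        card_gt_0_iff Suc_le_eq)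
  interpret tree_player k pos
  proof
    fix H :: "nat list set list"
    assume H: "valid_requests k H" "H \<noteq> []"
    then have "A M d (f []) (map ((`) f) H) \<in> last (map ((`) f) H)"
      using assms(3) inst unfolding online_algorithm_def by blast
    then show "pos H \<in> last H"
      using H by (auto simp: pos_def last_map)
  qed
  have alg: "alg_cost A M d (f []) (map ((`) f) Ss) = cost Ss" for Ss
  proof -
    let ?xs = "alg_path A M d (f []) (map ((`) f) Ss)"
    have len: "length ?xs = length Ss"
      by (simp add: alg_path_def del: upt_Suc)
    have nth: "g (?xs ! t) = pos (take (Suc t) Ss)" if "t < length Ss" for t
      using that by (auto simp: alg_path_def pos_def take_map nth_append simp del: upt_Suc)
    have "g ((f [] # ?xs) ! t) = pos (take t Ss)" if "t < length Ss" for t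
      using that nth by (cases t) (auto simp: pos_def)
    then show ?thesis
      unfolding alg_cost_def path_cost_def cost_def len
      using nth by (intro sum.cong) (auto simp: d_def)
  qed
  have "D_seq k \<le> \<rho>" if "competitive k \<rho> A" for \<rho>
  proof (rule ccontr)
    assume "\<not> D_seq k \<le> \<rho>"
    \<comment> \<open>\<open>\<rho>\<close> may be negative; \<open>max \<rho> 0\<close> lets the
      bound on the optimum be multiplied.\<close>
    define \<sigma> where "\<sigma> = (max \<rho> 0 + D_seq k) / 2"
    have \<sigma>: "max \<rho> 0 < \<sigma>" "\<sigma> < D_seq k"
      using \<open>\<not> D_seq k \<le> \<rho>\<close> D_seq_ge_one[OF assms(2)] by (auto simp: \<sigma>_def)
    then obtain C where "\<And>H F. valid_requests k H \<and> finite F \<and> card F + k \<le> k \<Longrightarrow>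
        \<exists>Ss r. outcome C \<sigma> H F (pos H) Ss r"
      using forces_D_seq[OF assms(2)] unfolding forces_def by blast
    moreover have nil: "pos [] = []" "cost [] = 0"
      by (simp add: pos_def) (simp add: cost_def)
    \<comment> \<open>With the kept set empty, the player has no escape and must pay.\<close>
    ultimately obtain Ss r where "outcome C \<sigma> [] {} [] Ss r"
      by (metis add_0 card.empty finite.emptyI order_refl valid_requests_def empty_iff list.set(1))
    then have out: "valid_requests k Ss" "descends [] Ss r" "0 < length r"
      "\<sigma> * real (length r) \<le> cost Ss"
      using nil by (auto simp: outcome_def)
    let ?Ts = "map ((`) f) Ss"
    let ?P = "{path_cost d (f []) xs | xs. list_all2 (\<in>) xs ?Ts}"
    obtain xs where xs: "list_all2 (\<in>) xs Ss" "path_cost tree_dist [] xs = real (length r)"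
      using descends_path[OF out(2)] by auto
    have path: "path_cost d (f q) (map f ys) = path_cost tree_dist q ys" for q ys
      by (induction ys arbitrary: q) (auto simp: d_def)
    have "list_all2 (\<in>) (map f xs) ?Ts"
      using xs(1) by (auto simp: list.rel_map elim!: list_all2_mono)
    then have mem: "real (length r) \<in> ?P"
      using path[of "[]" xs] xs(2) by force
    \<comment> \<open>Finiteness of the set of path costs is what gives \<open>Min\<close> its
      meaning.\<close>
    have "{xs. list_all2 (\<in>) xs ?Ts} \<subseteq> {xs. set xs \<subseteq> \<Union>(set ?Ts) \<and> length xs = length ?Ts}"
      by (fastforce simp: list_all2_conv_all_nth in_set_conv_nth)
    moreover have "finite (\<Union>(set ?Ts))"
      using out(1) by (auto simp: valid_requests_def)
    ultimately have "finite {xs. list_all2 (\<in>) xs ?Ts}"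
      using finite_lists_length_eq finite_subset by blast
    then have fin: "finite ?P"
      by simp
    have "opt_cost d (f []) ?Ts \<le> real (length r)"
      unfolding opt_cost_def using fin mem by (rule Min_le)
    moreover have "0 \<le> opt_cost d (f []) ?Ts"
      unfolding opt_cost_def using fin mem
      by (subst Min_ge_iff) (auto simp: path_cost_def d_def tree_dist_nonneg intro!: sum_nonneg)
    ultimately have "\<rho> * opt_cost d (f []) ?Ts \<le> max \<rho> 0 * real (length r)"
      by (intro mult_mono) auto
    also have "\<dots> < \<sigma> * real (length r)"
      using \<sigma> out(3) by (intro mult_strict_right_mono) auto
    also have "\<dots> \<le> alg_cost A M d (f []) ?Ts"
      using out(4) by (simp add: alg)
    finally show False
      using that inst[OF out(1)] unfolding competitive_def by fastforce
  qed
  then show ?thesis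
    unfolding competitive_ratio_def by (auto intro!: Inf_greatest)
qed

end
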